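(* Let $m_x,m_s,m_z>0$ and let $C$ be the capacity, under the non-negative input constraint with input mean at most $m_x$, of the additive exponential noise channel $Y=X+S+Z$ with noise mean $m_z$ and additive exponential interference of mean $m_s$ known non-causally at the transmitter. Then $$C\le \log\left(1+\frac{m_x}{m_z}\right).$$
   Context: Fix $m_x,m_s,m_z>0$. $S$ and $Z$ are independent exponentially distributed random variables with means $m_s$ and $m_z$. The channel is memoryless with output $Y_i=X_i+S_i+Z_i$, where $(S_i)$ and $(Z_i)$ are i.i.d. copies of $S$ and $Z$, independent of each other, and $(S_i)$ is known non-causally to the transmitter. The input $X$ is a non-negative random variable independent of $S$ and $Z$, with mean at most $m_x$ (for codewords, $\frac1n\sum_{i=1}^n X_i\le m_x$). The capacity is given by the Gelfand–Pinsker formula $$C=\sup_{p(u,x|s)}\{I(U;Y)-I(U;S)\},$$ where $Y=X+S+Z$, $U$ is an auxiliary random variable, and the supremum is over all conditional laws of $(U,X)$ given $S$ such that $X$ satisfies the input constraints, $I(U;S)<\infty$ (so that the difference is meaningful), and the joint law factors as $p(s)p(u,x|s)p(y|x,s)$, i.e. $Z$ is independent of $(S,U,X)$. $I$ denotes mutual information; $\log$ is the logarithm to a fixed base greater than $1$, the same as that used for mutual information. *)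

theory Defs
  imports "HOL-Probability.Probability"
begin

text \<open>The library parametrises the exponential distribution by its rate; here by its mean.\<close>

definition exponential_law :: "real \<Rightarrow> real measure" where
  "exponential_law m = density lborel (\<lambda>t. ennreal (exponential_density (1 / m) t))"

text \<open>
  The library's \<open>mutual_information\<close> is a real number: it is the Bochner integral of the
  information density, so it takes a meaningless value when the joint law is not absolutely
  continuous with respect to the product of the marginals or when the information density is
  not integrable. Its negative part is always integrable, so in exactly these two cases the
  mutual information is infinite.
\<close>

definition ext_mutual_information ::
    "real \<Rightarrow> 'a measure \<Rightarrow> 'b measure \<Rightarrow> 'c measure \<Rightarrow> ('a \<Rightarrow> 'b) \<Rightarrow> ('a \<Rightarrow> 'c) \<Rightarrow> ereal" where
  "ext_mutual_information b M A B V W =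
    (let P = distr M A V \<Otimes>\<^sub>M distr M B W;
         Q = distr M (A \<Otimes>\<^sub>M B) (\<lambda>\<omega>. (V \<omega>, W \<omega>))
     in if absolutely_continuous P Q \<and> integrable Q (entropy_density b P Q)
        then ereal (prob_space.mutual_information M b A B V W)
        else \<infinity>)"

text \<open>
  Outcomes are \<open>((s, u, x), z)\<close>. A conditional law \<open>p(u,x|s)\<close> is a Markov kernel \<open>K\<close>, and
  \<open>N\<close> is the alphabet of the auxiliary variable, an arbitrary measurable space. Since the law
  of \<open>Z\<close> enters as a product factor, \<open>Z\<close> is independent of \<open>(S, U, X)\<close>; the input \<open>X\<close> may depend
  on \<open>S\<close>, the interference being known at the transmitter.
\<close>

type_synonym 'u outcome = "(real \<times> 'u \<times> real) \<times> real"

definition S_of :: "'u outcome \<Rightarrow> real" where "S_of = (\<lambda>((s, u, x), z). s)"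
definition U_of :: "'u outcome \<Rightarrow> 'u" where "U_of = (\<lambda>((s, u, x), z). u)"
definition X_of :: "'u outcome \<Rightarrow> real" where "X_of = (\<lambda>((s, u, x), z). x)"
definition Z_of :: "'u outcome \<Rightarrow> real" where "Z_of = (\<lambda>((s, u, x), z). z)"

definition Y_of :: "'u outcome \<Rightarrow> real" where
  "Y_of = (\<lambda>\<omega>. X_of \<omega> + S_of \<omega> + Z_of \<omega>)"

definition joint_law ::
    "real \<Rightarrow> real \<Rightarrow> 'u measure \<Rightarrow> (real \<Rightarrow> ('u \<times> real) measure) \<Rightarrow> 'u outcome measure" where
  "joint_law ms mz N K =
    (exponential_law ms \<bind>
      (\<lambda>s. distr (K s) (borel \<Otimes>\<^sub>M N \<Otimes>\<^sub>M borel) (\<lambda>(u, x). (s, u, x))))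
    \<Otimes>\<^sub>M exponential_law mz"

definition gp_admissible ::
    "real \<Rightarrow> real \<Rightarrow> real \<Rightarrow> real \<Rightarrow> 'u measure \<Rightarrow> (real \<Rightarrow> ('u \<times> real) measure) \<Rightarrow> bool" where
  "gp_admissible b mx ms mz N K \<longleftrightarrow>
    K \<in> borel \<rightarrow>\<^sub>M prob_algebra (N \<Otimes>\<^sub>M borel) \<and>
    (let M = joint_law ms mz N K in
      (AE \<omega> in M. 0 \<le> X_of \<omega>) \<and>
      integrable M X_of \<and> prob_space.expectation M X_of \<le> mx \<and>
      ext_mutual_information b M N borel U_of S_of < \<infinity>)"

text \<open>
  HOL cannot quantify over types inside a term, so the type carrying the alphabets of \<open>U\<close> is a
  parameter; the supremum ranges over all measurable spaces on that type.
\<close>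

definition gp_capacity :: "'u itself \<Rightarrow> real \<Rightarrow> real \<Rightarrow> real \<Rightarrow> real \<Rightarrow> ereal" where
  "gp_capacity _ b mx ms mz =
    (SUP (N :: 'u measure, K) \<in> {(N, K). gp_admissible b mx ms mz N K}.
      let M = joint_law ms mz N K in
        ext_mutual_information b M N borel U_of Y_of - ext_mutual_information b M N borel U_of S_of)"

end

(* Revealing the interference to the receiver can only help: I(U;Y) - I(U;S) <= I(U;Y|S)
   <= h(X+Z|S) - h(Z), and among non-negative laws of mean at most mx + mz the exponential one
   maximises entropy. To avoid conditional laws and differential entropies, this is carried out
   as a single change of measure: the joint law is compared with the law under which U, S and
   Y - S are independent and Y - S is exponential of mean mx + mz. The likelihood ratio splits
   into the density whose mean logarithm is I(U;S) and an explicit function of X + Z and Z. *)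

theory Submission
  imports Defs
begin

section \<open>Radon-Nikodym derivatives as real functions\<close>

definition real_RN_deriv :: "'a measure \<Rightarrow> 'a measure \<Rightarrow> 'a \<Rightarrow> real" where
  "real_RN_deriv P Q x = enn2real (RN_deriv P Q x)"

lemma borel_measurable_real_RN_deriv [measurable]: "real_RN_deriv P Q \<in> borel_measurable P"
  unfolding real_RN_deriv_def by measurable

lemma entropy_density_eq_log: "entropy_density b P Q x = log b (real_RN_deriv P Q x)"
  by (simp add: entropy_density_def real_RN_deriv_def)

text \<open>Serves three pairs: the law of the output against its reference law, and the joint laws
  of (U, Y) and of (U, S) against the products of their marginals.\<close>

locale rn_pair = P: prob_space P + Q: prob_space Q for P Q :: "'a measure" +
  assumes ac: "absolutely_continuous P Q"
    and sets_eq [measurable_cong]: "sets Q = sets P"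
begin

text \<open>As \<open>Q\<close> is finite, the derivative is finite \<open>P\<close>-almost
  everywhere, so sending infinity to 0 does not change the density.\<close>

lemma density_real_RN_deriv: "density P (\<lambda>x. ennreal (real_RN_deriv P Q x)) = Q"
proof -
  have "AE x in P. RN_deriv P Q x \<noteq> \<infinity>"
    by (rule P.RN_deriv_finite[OF _ ac sets_eq]) unfold_locales
  then have "AE x in P. ennreal (real_RN_deriv P Q x) = RN_deriv P Q x"
    by eventually_elim (auto simp: real_RN_deriv_def top.not_eq_extremum)
  then have "density P (\<lambda>x. ennreal (real_RN_deriv P Q x)) = density P (RN_deriv P Q)"
    by (intro density_cong) auto
  then show ?thesis
    using P.density_RN_deriv[OF ac sets_eq] by simp
qed

lemma nn_integral_eq:
  assumes [measurable]: "f \<in> borel_measurable P"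
  shows "(\<integral>\<^sup>+x. f x \<partial>Q) = (\<integral>\<^sup>+x. ennreal (real_RN_deriv P Q x) * f x \<partial>P)"
  by (subst density_real_RN_deriv[symmetric]) (simp add: nn_integral_density)

text \<open>A measure gives no mass to the set where its own density vanishes.\<close>

lemma AE_real_RN_deriv_pos: "AE x in Q. 0 < real_RN_deriv P Q x"
proof -
  have "AE x in density P (\<lambda>x. ennreal (real_RN_deriv P Q x)). 0 < real_RN_deriv P Q x"
    by (subst AE_density) auto
  then show ?thesis
    unfolding density_real_RN_deriv .
qed

text \<open>The product of the derivative and its reciprocal is 1 where the derivative is positive
  and, since \<open>1 / 0 = 0\<close>, it is 0 elsewhere. \<open>P\<close> may charge the latter
  set, hence an inequality only.\<close>

lemma nn_integral_inverse_le:
  assumes [measurable]: "f \<in> borel_measurable P"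
  shows "(\<integral>\<^sup>+x. ennreal (1 / real_RN_deriv P Q x) * f x \<partial>Q) \<le> (\<integral>\<^sup>+x. f x \<partial>P)"
proof -
  have "ennreal r * (ennreal (1 / r) * y) \<le> y" if "0 \<le> r" for r y
    using that by (cases "r = 0") (auto simp: mult.assoc[symmetric] ennreal_mult[symmetric])
  then show ?thesis
    by (subst nn_integral_eq) (auto intro!: nn_integral_mono simp: real_RN_deriv_def)
qed

end

section \<open>Bounding mutual information against a reference law\<close>

text \<open>
  The bound is the Gibbs inequality for the two likelihood ratios \<open>j h / W\<close> and \<open>1 / h\<close>, where
  \<open>j\<close> is the density of the joint law of \<open>(U, Y)\<close> relative to the product of its marginals and
  \<open>h\<close> that of the law of \<open>Y\<close> relative to \<open>Q\<close>: both have mean at most 1, so their logarithms have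
  mean at most 0.
\<close>

lemma ext_mutual_information_le:
  fixes W :: "'a \<Rightarrow> real"
  assumes "prob_space M" and "prob_space Q" and b: "1 < b"
    and [measurable]: "U \<in> M \<rightarrow>\<^sub>M N" "Y \<in> M \<rightarrow>\<^sub>M T" "W \<in> borel_measurable M"
    and [measurable_cong]: "sets Q = sets T"
    and W_pos: "AE \<omega> in M. 0 < W \<omega>"
    and W_int: "integrable M (\<lambda>\<omega>. ln (W \<omega>))"
    and bound: "\<And>\<phi>. \<phi> \<in> borel_measurable (N \<Otimes>\<^sub>M T) \<Longrightarrow>
      (\<integral>\<^sup>+\<omega>. \<phi> (U \<omega>, Y \<omega>) * ennreal (1 / W \<omega>) \<partial>M) \<le> (\<integral>\<^sup>+p. \<phi> p \<partial>(distr M N U \<Otimes>\<^sub>M Q))"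
  shows "ext_mutual_information b M N T U Y \<le> ereal (\<integral>\<omega>. log b (W \<omega>) \<partial>M)"
proof -
  interpret M: prob_space M by fact
  interpret Q: prob_space Q by fact
  define A where "A = distr M N U"
  define B where "B = distr M T Y"
  define J where "J = distr M (N \<Otimes>\<^sub>M T) (\<lambda>\<omega>. (U \<omega>, Y \<omega>))"
  have [measurable_cong]: "sets A = sets N" "sets B = sets T" "sets J = sets (N \<Otimes>\<^sub>M T)"
    by (auto simp: A_def B_def J_def)
  interpret A: prob_space A unfolding A_def by (rule M.prob_space_distr) measurable
  interpret B: prob_space B unfolding B_def by (rule M.prob_space_distr) measurable
  interpret J: prob_space J unfolding J_def by (rule M.prob_space_distr) measurable
  interpret AQ: pair_prob_space A Q ..
  interpret AB: pair_prob_space A B ..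
  have sets_AQ: "sets (A \<Otimes>\<^sub>M Q) = sets (N \<Otimes>\<^sub>M T)" and sets_AB: "sets (A \<Otimes>\<^sub>M B) = sets (N \<Otimes>\<^sub>M T)"
    by (auto intro!: sets_pair_measure_cong simp: A_def B_def assms(7))
  \<comment> \<open>The law of (U, Y) is absolutely continuous with respect to
    \<open>A \<Otimes>\<^sub>M Q\<close>: in \<open>bound\<close> take the indicator of a null set;
    the weight \<open>1 / W\<close> is almost surely positive.\<close>
  have AE_J: "AE \<omega> in M. (U \<omega>, Y \<omega>) \<notin> X"
    if "X \<in> null_sets (A \<Otimes>\<^sub>M Q)" for X
  proof -
    have [measurable]: "X \<in> sets (N \<Otimes>\<^sub>M T)"
      using that sets_AQ by auto
    have "(\<integral>\<^sup>+\<omega>. indicator X (U \<omega>, Y \<omega>) * ennreal (1 / W \<omega>) \<partial>M) \<le> 0"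
      using bound[of "indicator X"] that sets_AQ by (simp add: A_def[symmetric] null_setsD1)
    then have "AE \<omega> in M. indicator X (U \<omega>, Y \<omega>) * ennreal (1 / W \<omega>) = 0"
      by (subst (asm) le_zero_eq, subst (asm) nn_integral_0_iff_AE) auto
    with W_pos show ?thesis
      by eventually_elim (auto simp: indicator_def split: if_splits)
  qed
  \<comment> \<open>A \<open>Q\<close>-null set of outputs yields a null cylinder in the product, to
    which \<open>AE_J\<close> applies.\<close>
  have ac_BQ: "absolutely_continuous Q B"
    unfolding absolutely_continuous_def
  proof
    fix X assume X: "X \<in> null_sets Q"
    then have [measurable]: "X \<in> sets T"
      using \<open>sets Q = sets T\<close> by auto
    have "space N \<times> X \<in> null_sets (A \<Otimes>\<^sub>M Q)"
      using X by (auto simp: null_sets_def Q.emeasure_pair_measure_Times)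
    from AE_J[OF this] have "AE \<omega> in M. Y \<omega> \<notin> X"
      using AE_space by eventually_elim (auto dest: measurable_space[OF \<open>U \<in> M \<rightarrow>\<^sub>M N\<close>])
    then have "AE y in B. y \<notin> X"
      unfolding B_def by (subst AE_distr_iff) auto
    then show "X \<in> null_sets B"
      by (subst (asm) AE_iff_null_sets[symmetric]) auto
  qed
  interpret h: rn_pair Q B
    by unfold_locales (use ac_BQ in \<open>auto simp: B_def assms(7)\<close>)
  define h where "h = real_RN_deriv Q B"
  have [measurable]: "h \<in> borel_measurable T" unfolding h_def by measurable
  have h_pos: "AE \<omega> in M. 0 < h (Y \<omega>)"
    using h.AE_real_RN_deriv_pos unfolding B_def h_def[symmetric, unfolded B_def]
    by (subst (asm) AE_distr_iff) auto
  have AB_eq: "(\<integral>\<^sup>+p. f p \<partial>(A \<Otimes>\<^sub>M B)) = (\<integral>\<^sup>+p. ennreal (h (snd p)) * f p \<partial>(A \<Otimes>\<^sub>M Q))"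
    if [measurable]: "f \<in> borel_measurable (N \<Otimes>\<^sub>M T)" for f
  proof -
    have "(\<integral>\<^sup>+p. f p \<partial>(A \<Otimes>\<^sub>M B)) = (\<integral>\<^sup>+u. \<integral>\<^sup>+y. f (u, y) \<partial>B \<partial>A)"
      by (rule B.nn_integral_fst[symmetric]) measurable
    also have "\<dots> = (\<integral>\<^sup>+u. \<integral>\<^sup>+y. ennreal (h (snd (u, y))) * f (u, y) \<partial>Q \<partial>A)"
    proof (rule nn_integral_cong)
      fix u assume "u \<in> space A"
      then have [measurable]: "u \<in> space N" by (simp add: A_def)
      have "(\<lambda>y. f (u, y)) \<in> borel_measurable Q"
        by (subst measurable_cong_sets[OF assms(7) refl]) measurable
      then show "(\<integral>\<^sup>+y. f (u, y) \<partial>B) = (\<integral>\<^sup>+y. ennreal (h (snd (u, y))) * f (u, y) \<partial>Q)"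
        unfolding h_def snd_conv by (rule h.nn_integral_eq)
    qed
    also have "\<dots> = (\<integral>\<^sup>+p. ennreal (h (snd p)) * f p \<partial>(A \<Otimes>\<^sub>M Q))"
      by (rule Q.nn_integral_fst) measurable
    finally show ?thesis .
  qed
  \<comment> \<open>A null set of \<open>A \<Otimes>\<^sub>M B\<close> is null for
    \<open>A \<Otimes>\<^sub>M Q\<close> once the zeros of \<open>h\<close> are removed, and
    \<open>h (Y \<omega>)\<close> is almost surely positive.\<close>
  have ac_J: "absolutely_continuous (A \<Otimes>\<^sub>M B) J"
    unfolding absolutely_continuous_def
  proof
    fix X assume X: "X \<in> null_sets (A \<Otimes>\<^sub>M B)"
    then have [measurable]: "X \<in> sets (N \<Otimes>\<^sub>M T)"
      using sets_AB by auto
    have "(\<integral>\<^sup>+p. ennreal (h (snd p)) * indicator X p \<partial>(A \<Otimes>\<^sub>M Q)) = 0"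
      using X sets_AB by (subst AB_eq[symmetric]) auto
    then have "AE p in A \<Otimes>\<^sub>M Q. ennreal (h (snd p)) * indicator X p = 0"
      by (subst (asm) nn_integral_0_iff_AE) auto
    then have "{p \<in> space (A \<Otimes>\<^sub>M Q). ennreal (h (snd p)) * indicator X p \<noteq> 0} \<in> null_sets (A \<Otimes>\<^sub>M Q)"
      by (subst (asm) AE_iff_null) auto
    from AE_J[OF this] h_pos AE_space have "AE \<omega> in M. (U \<omega>, Y \<omega>) \<notin> X"
      by eventually_elim
        (auto simp: space_pair_measure indicator_def A_def sets_eq_imp_space_eq[OF assms(7)]
          dest: measurable_space[OF \<open>U \<in> M \<rightarrow>\<^sub>M N\<close>] measurable_space[OF \<open>Y \<in> M \<rightarrow>\<^sub>M T\<close>])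
    then have "AE p in J. p \<notin> X"
      unfolding J_def by (subst AE_distr_iff) auto
    then show "X \<in> null_sets J"
      by (subst (asm) AE_iff_null_sets[symmetric]) auto
  qed
  interpret j: rn_pair "A \<Otimes>\<^sub>M B" J
    by unfold_locales (use ac_J sets_AB in \<open>auto simp: J_def\<close>)
  define j where "j = real_RN_deriv (A \<Otimes>\<^sub>M B) J"
  have j_AB [measurable]: "j \<in> borel_measurable (N \<Otimes>\<^sub>M T)" unfolding j_def by measurable
  have j_nn: "0 \<le> j p" and h_nn: "0 \<le> h y" for p y
    by (auto simp: j_def h_def real_RN_deriv_def)
  have j_pos: "AE \<omega> in M. 0 < j (U \<omega>, Y \<omega>)"
    using j.AE_real_RN_deriv_pos unfolding J_def j_def[symmetric, unfolded J_def]
    by (subst (asm) AE_distr_iff) auto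

  \<comment> \<open>The first likelihood ratio. Its mean is bounded by taking \<open>h * j\<close>
    in \<open>bound\<close>: the factor \<open>h\<close> turns \<open>Q\<close> into
    \<open>B\<close>, and \<open>j\<close> then integrates to the total mass of
    \<open>J\<close>.\<close>
  let ?t = "\<lambda>\<omega>. j (U \<omega>, Y \<omega>) * h (Y \<omega>) / W \<omega>"
  have "(\<integral>\<^sup>+\<omega>. ennreal (?t \<omega>) \<partial>M)
      = (\<integral>\<^sup>+\<omega>. (\<lambda>p. ennreal (h (snd p)) * ennreal (j p)) (U \<omega>, Y \<omega>) * ennreal (1 / W \<omega>) \<partial>M)"
    using W_pos by (intro nn_integral_cong_AE, eventually_elim)
      (simp add: ennreal_mult[symmetric] j_nn h_nn mult.commute)
  also have "\<dots> \<le> (\<integral>\<^sup>+p. ennreal (h (snd p)) * ennreal (j p) \<partial>(A \<Otimes>\<^sub>M Q))"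
    unfolding A_def by (rule bound) measurable
  also have "\<dots> = (\<integral>\<^sup>+p. ennreal (j p) * 1 \<partial>(A \<Otimes>\<^sub>M B))"
    by (subst AB_eq) auto
  also have "\<dots> = 1"
    unfolding j_def by (subst j.nn_integral_eq[symmetric]) (auto simp: J.emeasure_space_1)
  finally have t: "(\<integral>\<^sup>+\<omega>. ennreal (?t \<omega>) \<partial>M) \<le> 1" .
  have t_nn: "AE \<omega> in M. 0 \<le> ?t \<omega>"
    using W_pos by eventually_elim (simp add: j_nn h_nn)
  have t_int: "integrable M ?t"
    by (rule integrableI_nonneg[OF _ t_nn]) (use t in \<open>auto intro: le_less_trans\<close>)
  have "ennreal (\<integral>\<omega>. ?t \<omega> \<partial>M) \<le> 1"
    using nn_integral_eq_integral[OF t_int t_nn] t by simp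
  then have t_le: "(\<integral>\<omega>. ?t \<omega> \<partial>M) \<le> 1"
    by simp

  \<comment> \<open>The second likelihood ratio, \<open>1 / h\<close>, also has mean at most
    1.\<close>
  have "(\<integral>\<^sup>+\<omega>. ennreal (1 / h (Y \<omega>)) \<partial>M) = (\<integral>\<^sup>+y. ennreal (1 / h y) * 1 \<partial>B)"
    unfolding B_def by (subst nn_integral_distr) auto
  also have "\<dots> \<le> 1"
    unfolding h_def by (rule order_trans[OF h.nn_integral_inverse_le]) (auto simp: Q.emeasure_space_1)
  finally have h1: "(\<integral>\<^sup>+\<omega>. ennreal (1 / h (Y \<omega>)) \<partial>M) \<le> 1" .
  have h_int: "integrable M (\<lambda>\<omega>. 1 / h (Y \<omega>))"
    by (rule integrableI_nonneg) (use h1 in \<open>auto intro: le_less_trans simp: h_nn\<close>)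
  have "ennreal (\<integral>\<omega>. 1 / h (Y \<omega>) \<partial>M) \<le> 1"
    using nn_integral_eq_integral[OF h_int] h1 by (simp add: h_nn)
  then have h_le: "(\<integral>\<omega>. 1 / h (Y \<omega>) \<partial>M) \<le> 1"
    by simp

  have "(\<integral>\<^sup>+\<omega>. ennreal (1 / j (U \<omega>, Y \<omega>)) \<partial>M) = (\<integral>\<^sup>+p. ennreal (1 / j p) * 1 \<partial>J)"
    unfolding J_def by (subst nn_integral_distr) auto
  also have "\<dots> \<le> 1"
    unfolding j_def
    by (rule order_trans[OF j.nn_integral_inverse_le]) (auto simp: AB.emeasure_space_1)
  finally have j_int: "integrable M (\<lambda>\<omega>. 1 / j (U \<omega>, Y \<omega>))"
    by (intro integrableI_nonneg) (auto intro: le_less_trans simp: j_nn)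

  let ?l = "\<lambda>\<omega>. ln (j (U \<omega>, Y \<omega>))"
  \<comment> \<open>From \<open>j = W * ?t * (1 / h)\<close> and \<open>ln x \<le> x - 1\<close> for
    the last two factors; the two subtracted ones give the 2.\<close>
  let ?u = "\<lambda>\<omega>. ln (W \<omega>) + ?t \<omega> + 1 / h (Y \<omega>) - 2"
  \<comment> \<open>The same inequality at \<open>1 / j\<close>, giving an integrable
    minorant.\<close>
  have lower: "AE \<omega> in M. 1 - 1 / j (U \<omega>, Y \<omega>) \<le> ?l \<omega>"
    using j_pos
  proof eventually_elim
    case (elim \<omega>)
    then show ?case
      using ln_le_minus_one[of "1 / j (U \<omega>, Y \<omega>)"] by (simp add: ln_div)
  qed
  have upper: "AE \<omega> in M. ?l \<omega> \<le> ?u \<omega>"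
    using j_pos h_pos W_pos
  proof eventually_elim
    case (elim \<omega>)
    then show ?case
      using ln_le_minus_one[of "?t \<omega>"] ln_le_minus_one[of "1 / h (Y \<omega>)"]
      by (simp add: ln_div ln_mult)
  qed
  have u_int: "integrable M ?u"
    using W_int t_int h_int by auto
  \<comment> \<open>Being caught between integrable functions makes the information density
    integrable, which rules out the infinite branch of
    \<open>ext_mutual_information\<close>.\<close>
  have l_int: "integrable M ?l"
  proof (rule Bochner_Integration.integrable_bound)
    show "integrable M (\<lambda>\<omega>. \<bar>?u \<omega>\<bar> + \<bar>1 - 1 / j (U \<omega>, Y \<omega>)\<bar>)"
      using u_int j_int by auto
    have sandwich: "norm l \<le> norm (\<bar>u\<bar> + \<bar>a\<bar>)" if "a \<le> l" "l \<le> u" for a l u :: real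
      using that by (simp add: abs_if)
    show "AE \<omega> in M. norm (?l \<omega>) \<le> norm (\<bar>?u \<omega>\<bar> + \<bar>1 - 1 / j (U \<omega>, Y \<omega>)\<bar>)"
      using lower upper by eventually_elim (rule sandwich)
  qed measurable
  have "(\<integral>\<omega>. ?l \<omega> \<partial>M) \<le> (\<integral>\<omega>. ?u \<omega> \<partial>M)"
    using l_int u_int upper by (rule integral_mono_AE)
  also have "\<dots> = (\<integral>\<omega>. ln (W \<omega>) \<partial>M) + (\<integral>\<omega>. ?t \<omega> \<partial>M) + (\<integral>\<omega>. 1 / h (Y \<omega>) \<partial>M) - 2"
    using W_int t_int h_int by (simp add: M.prob_space)
  also have "\<dots> \<le> (\<integral>\<omega>. ln (W \<omega>) \<partial>M)"
    using t_le h_le by linarith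
  finally have main: "(\<integral>\<omega>. ?l \<omega> \<partial>M) \<le> (\<integral>\<omega>. ln (W \<omega>) \<partial>M)" .
  have ed: "entropy_density b (A \<Otimes>\<^sub>M B) J = (\<lambda>p. ln (j p) / ln b)"
    by (simp add: fun_eq_iff entropy_density_eq_log log_def j_def)
  have ed_int: "integrable J (entropy_density b (A \<Otimes>\<^sub>M B) J)"
    unfolding ed unfolding J_def using l_int by (subst integrable_distr_eq) auto
  have "M.mutual_information b N T U Y = (\<integral>p. ln (j p) / ln b \<partial>J)"
    by (simp add: M.mutual_information_def KL_divergence_def A_def[symmetric] B_def[symmetric]
        J_def[symmetric] ed)
  also have "\<dots> = (\<integral>\<omega>. ?l \<omega> \<partial>M) / ln b"
    unfolding J_def by (subst integral_distr) auto
  also have "\<dots> \<le> (\<integral>\<omega>. ln (W \<omega>) \<partial>M) / ln b"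
    using main b by (simp add: divide_right_mono)
  also have "\<dots> = (\<integral>\<omega>. log b (W \<omega>) \<partial>M)"
    by (simp add: log_def)
  finally show ?thesis
    using ac_J ed_int
    by (simp add: ext_mutual_information_def Let_def A_def[symmetric] B_def[symmetric] J_def[symmetric])
qed

section \<open>The exponential law and the law of (S, U, X)\<close>

lemma prob_space_exponential_law: "0 < m \<Longrightarrow> prob_space (exponential_law m)"
  unfolding exponential_law_def by (rule prob_space_exponential_density) simp

lemma sets_exponential_law [measurable_cong, simp]: "sets (exponential_law m) = sets borel"
  by (simp add: exponential_law_def)

text \<open>Attaching \<open>s\<close> to the outcome of \<open>K s\<close> gives a probability
  measure depending measurably on \<open>s\<close>, so the mixture over \<open>s\<close> is a
  probability measure on triples.\<close>

lemma joint_law_factor: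
  assumes "0 < ms" and K: "K \<in> borel \<rightarrow>\<^sub>M prob_algebra (N \<Otimes>\<^sub>M borel)"
  defines "P \<equiv> exponential_law ms \<bind>
      (\<lambda>s. distr (K s) (borel \<Otimes>\<^sub>M N \<Otimes>\<^sub>M borel) (\<lambda>(u, x). (s, u, x)))"
  shows "prob_space P" and "sets P = sets (borel \<Otimes>\<^sub>M N \<Otimes>\<^sub>M borel)"
proof -
  interpret E: prob_space "exponential_law ms"
    using \<open>0 < ms\<close> by (rule prob_space_exponential_law)
  have D: "(\<lambda>s. distr (K s) (borel \<Otimes>\<^sub>M N \<Otimes>\<^sub>M borel) (\<lambda>(u, x). (s, u, x)))
      \<in> exponential_law ms \<rightarrow>\<^sub>M prob_algebra (borel \<Otimes>\<^sub>M N \<Otimes>\<^sub>M borel)"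
    by (rule measurable_distr_prob_space2[where M = "N \<Otimes>\<^sub>M borel"]) (use K in measurable)
  then show "prob_space P"
    unfolding P_def
    by (intro E.prob_space_bind[OF _ measurable_prob_algebraD[OF D]] AE_I2)
      (auto dest: measurable_space simp: space_prob_algebra)
  show "sets P = sets (borel \<Otimes>\<^sub>M N \<Otimes>\<^sub>M borel)"
    unfolding P_def by (rule sets_bind) (auto simp: E.not_empty)
qed

section \<open>The bound for a single admissible choice\<close>

text \<open>
  The reference law makes \<open>(U, S)\<close> independent and gives \<open>Y - S\<close>, independently of them, the
  exponential law of mean \<open>mx + mz\<close>, the largest mean that \<open>X + Z\<close> can have.
\<close>

lemma mutual_information_difference_le:
  fixes P :: "(real \<times> 'u \<times> real) measure"
  assumes b: "1 < b" and mx: "0 < mx" and mz: "0 < mz"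
    and "prob_space P" and sets_P [measurable_cong]: "sets P = sets (borel \<Otimes>\<^sub>M N \<Otimes>\<^sub>M borel)"
  defines "M \<equiv> P \<Otimes>\<^sub>M exponential_law mz"
  assumes X_nn: "AE \<omega> in M. 0 \<le> X_of \<omega>"
    and X_int: "integrable M X_of" and X_le: "prob_space.expectation M X_of \<le> mx"
    and US: "ext_mutual_information b M N borel U_of S_of < \<infinity>"
  shows "ext_mutual_information b M N borel U_of Y_of
    \<le> ext_mutual_information b M N borel U_of S_of + ereal (log b (1 + mx / mz))"
proof -
  define m where "m = mx + mz"
  have m: "0 < m" using mx mz by (simp add: m_def)
  let ?f = "exponential_density (1 / mz)"
  let ?q = "exponential_density (1 / m)"
  interpret P: prob_space P by fact
  interpret E: prob_space "exponential_law mz"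
    using mz by (rule prob_space_exponential_law)
  interpret E': prob_space "exponential_law m"
    using m by (rule prob_space_exponential_law)
  interpret M: prob_space M
    unfolding M_def by (rule prob_space_pair) unfold_locales
  have of_eq: "S_of = (\<lambda>\<omega>. fst (fst \<omega>))" "U_of = (\<lambda>\<omega>. fst (snd (fst \<omega>)))"
      "X_of = (\<lambda>\<omega>. snd (snd (fst \<omega>)))" "Z_of = snd"
    by (auto simp: S_of_def U_of_def X_of_def Z_of_def fun_eq_iff)
  have sets_M [measurable_cong]: "sets M = sets ((borel \<Otimes>\<^sub>M N \<Otimes>\<^sub>M borel) \<Otimes>\<^sub>M borel)"
    unfolding M_def by (intro sets_pair_measure_cong sets_P sets_exponential_law)
  have [measurable]: "S_of \<in> M \<rightarrow>\<^sub>M borel" "U_of \<in> M \<rightarrow>\<^sub>M N" "X_of \<in> M \<rightarrow>\<^sub>M borel" "Z_of \<in> M \<rightarrow>\<^sub>M borel"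
    unfolding of_eq by measurable
  have [measurable]: "Y_of \<in> M \<rightarrow>\<^sub>M borel"
    unfolding Y_of_def by measurable

  define A where "A = distr M N U_of"
  define B where "B = distr M borel S_of"
  define J where "J = distr M (N \<Otimes>\<^sub>M borel) (\<lambda>\<omega>. (U_of \<omega>, S_of \<omega>))"
  have [measurable_cong]: "sets A = sets N" "sets B = sets borel" "sets J = sets (N \<Otimes>\<^sub>M borel)"
    by (auto simp: A_def B_def J_def)
  interpret A: prob_space A unfolding A_def by (rule M.prob_space_distr) measurable
  interpret B: prob_space B unfolding B_def by (rule M.prob_space_distr) measurable
  interpret J: prob_space J unfolding J_def by (rule M.prob_space_distr) measurable
  interpret AB: pair_prob_space A B ..
  interpret BE: pair_prob_space B "exponential_law m" ..
  \<comment> \<open>Finiteness of I(U;S) selects the branch of the definition in which the density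
    \<open>r\<close> exists and has integrable logarithm.\<close>
  have ac: "absolutely_continuous (A \<Otimes>\<^sub>M B) J"
    and ed_int: "integrable J (entropy_density b (A \<Otimes>\<^sub>M B) J)"
    and US_eq: "ext_mutual_information b M N borel U_of S_of
      = ereal (M.mutual_information b N borel U_of S_of)"
    using US by (auto simp: ext_mutual_information_def Let_def A_def B_def J_def split: if_splits)
  interpret r: rn_pair "A \<Otimes>\<^sub>M B" J
    by unfold_locales (use ac in \<open>auto simp: J_def A_def B_def intro!: sets_pair_measure_cong\<close>)
  define r where "r = real_RN_deriv (A \<Otimes>\<^sub>M B) J"
  have [measurable]: "r \<in> borel_measurable (N \<Otimes>\<^sub>M borel)" unfolding r_def by measurable
  have r_nn: "0 \<le> r p" for p by (simp add: r_def real_RN_deriv_def)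
  have r_pos: "AE \<omega> in M. 0 < r (U_of \<omega>, S_of \<omega>)"
    using r.AE_real_RN_deriv_pos unfolding J_def r_def[symmetric, unfolded J_def]
    by (subst (asm) AE_distr_iff) auto

  \<comment> \<open>For non-negative \<open>x\<close> and \<open>z\<close>, the ratio of the density
    of Z at \<open>z\<close> to the exponential density of mean \<open>m\<close> at
    \<open>x + z\<close>.\<close>
  define w where "w x z = (m / mz) * exp ((x + z) / m - z / mz)" for x z
  have w_pos: "0 < w x z" for x z using m mz by (simp add: w_def)
  \<comment> \<open>Equality for \<open>0 \<le> z\<close>; for negative \<open>z\<close> the left
    side is 0 while \<open>x + z\<close> may still be non-negative.\<close>
  have w_ratio: "?f z * (1 / w x z) \<le> ?q (x + z)" if "0 \<le> x" for x z
  proof (cases "z < 0")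
    case True
    then show ?thesis using m by (simp add: exponential_density_def)
  next
    case False
    have "1 / w x z = (mz / m) * exp (z / mz - (x + z) / m)"
      by (simp add: w_def exp_diff)
    then have "?f z * (1 / w x z) = 1 / m * (exp (- z / mz) * exp (z / mz - (x + z) / m))"
      using False mz by (simp add: exponential_density_def)
    also have "\<dots> = ?q (x + z)"
      using False that by (simp add: exponential_density_def exp_add[symmetric] add_divide_distrib diff_divide_distrib)
    finally show ?thesis by simp
  qed
  have [measurable]: "(\<lambda>p. w (f p) (g p)) \<in> borel_measurable M'"
    if [measurable]: "f \<in> borel_measurable M'" "g \<in> borel_measurable M'" for f g and M' :: "'z measure"
    unfolding w_def by measurable
  \<comment> \<open>The likelihood ratio of the true law to the reference law: \<open>r\<close>
    accounts for the dependence of U and S, \<open>w\<close> for replacing Y - S by an independent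
    exponential variable.\<close>
  define W where "W \<omega> = r (U_of \<omega>, S_of \<omega>) * w (X_of \<omega>) (Z_of \<omega>)" for \<omega>
  \<comment> \<open>The law of Y under the reference law.\<close>
  define Q where "Q = distr (B \<Otimes>\<^sub>M exponential_law m) borel (\<lambda>(s, t). s + t)"

  have distr_Z: "distributed M lborel Z_of ?f"
  proof -
    have "distr M lborel Z_of = exponential_law mz"
    proof (rule measure_eqI)
      fix X assume "X \<in> sets (distr M lborel Z_of)"
      then have X [measurable]: "X \<in> sets borel" by simp
      have "emeasure (distr M lborel Z_of) X = emeasure M (space P \<times> X)"
        by (subst emeasure_distr)
          (auto simp: of_eq M_def space_pair_measure sets_eq_imp_space_eq[OF sets_exponential_law]
            intro!: arg_cong[where f = "emeasure _"])
      also have "\<dots> = emeasure (exponential_law mz) X"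
        unfolding M_def by (subst E.emeasure_pair_measure_Times) (auto simp: P.emeasure_space_1)
      finally show "emeasure (distr M lborel Z_of) X = emeasure (exponential_law mz) X" .
    qed simp
    then show ?thesis
      by (auto simp: distributed_def exponential_law_def)
  qed
  \<comment> \<open>\<open>exponential_density\<close> is the Erlang density of shape index 0, so
    its first Erlang moment gives integrability.\<close>
  have Z_int: "integrable M Z_of" and Z_eq: "M.expectation Z_of = mz"
    using M.erlang_ith_moment_integrable[OF _ distr_Z, of 1]
      M.exponential_distributed_expectation[OF _ distr_Z] mz by auto

  have Q: "prob_space Q"
    unfolding Q_def by (rule BE.prob_space_distr) measurable
  have sets_Q [measurable_cong]: "sets Q = sets borel"
    by (simp add: Q_def)
  interpret Q: prob_space Q by fact

  have Q_bound: "(\<integral>\<^sup>+\<omega>. \<phi> (U_of \<omega>, Y_of \<omega>) * ennreal (1 / W \<omega>) \<partial>M) \<le> (\<integral>\<^sup>+p. \<phi> p \<partial>(A \<Otimes>\<^sub>M Q))"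
    if [measurable]: "\<phi> \<in> borel_measurable (N \<Otimes>\<^sub>M borel)" for \<phi>
  proof -
    \<comment> \<open>The mean of \<open>\<phi> (U, Y)\<close> under the reference law, given U and
      S.\<close>
    define \<Phi> where "\<Phi> p = (\<integral>\<^sup>+t. \<phi> (fst p, snd p + t) \<partial>exponential_law m)" for p
    have [measurable]: "\<Phi> \<in> borel_measurable (N \<Otimes>\<^sub>M borel)"
      unfolding \<Phi>_def by measurable
    \<comment> \<open>Setting the weight to 0 for negative \<open>x\<close> makes
      \<open>fc_le\<close> hold everywhere; almost surely X is non-negative, so the integral over
      \<open>M\<close> is unaffected.\<close>
    define c where "c x z = (if 0 \<le> x then 1 / w x z else 0)" for x z
    have [measurable]: "(\<lambda>p. c (f p) (g p)) \<in> borel_measurable M'"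
      if [measurable]: "f \<in> borel_measurable M'" "g \<in> borel_measurable M'"
      for f g and M' :: "'z measure"
      unfolding c_def by measurable
    have c_nn: "0 \<le> c x z" for x z
      using w_pos[of x z] by (simp add: c_def)
    have fc_le: "?f z * c x z \<le> ?q (x + z)" for x z
      using w_ratio[of x z] m by (auto simp: c_def exponential_density_nonneg)
    \<comment> \<open>Integrating out Z first, with U, S and X fixed, leaves a bound free of
      \<open>x\<close>.\<close>
    have inner: "(\<integral>\<^sup>+z. \<phi> (u, x + s + z) * ennreal (1 / r (u, s)) * ennreal (c x z) \<partial>exponential_law mz)
        \<le> ennreal (1 / r (u, s)) * \<Phi> (u, s)" if [measurable]: "u \<in> space N" for s u x
    proof -
      have "(\<integral>\<^sup>+z. \<phi> (u, x + s + z) * ennreal (1 / r (u, s)) * ennreal (c x z) \<partial>exponential_law mz)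
        = (\<integral>\<^sup>+z. ennreal (?f z) * (\<phi> (u, x + s + z) * ennreal (1 / r (u, s)) * ennreal (c x z)) \<partial>lborel)"
        unfolding exponential_law_def by (rule nn_integral_density) measurable
      also have "\<dots> = (\<integral>\<^sup>+z. ennreal (1 / r (u, s)) * (ennreal (?f z * c x z) * \<phi> (u, x + s + z)) \<partial>lborel)"
        using mz by (intro nn_integral_cong)
          (simp add: ennreal_mult exponential_density_nonneg c_nn mult_ac)
      also have "\<dots> = (\<integral>\<^sup>+z. ennreal (1 / r (u, s)) * (ennreal (?f z * c x z) * \<phi> (u, s + (x + z))) \<partial>lborel)"
        by (simp add: add_ac)
      also have "\<dots> \<le> (\<integral>\<^sup>+z. ennreal (1 / r (u, s)) * (ennreal (?q (x + z)) * \<phi> (u, s + (x + z))) \<partial>lborel)"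
        by (intro nn_integral_mono mult_left_mono mult_right_mono ennreal_leI fc_le) auto
      also have "\<dots> = ennreal (1 / r (u, s)) * (\<integral>\<^sup>+z. ennreal (?q (x + z)) * \<phi> (u, s + (x + z)) \<partial>lborel)"
        by (rule nn_integral_cmult) measurable
      \<comment> \<open>Translation invariance of Lebesgue measure, with
        \<open>t = x + z\<close>.\<close>
      also have "(\<integral>\<^sup>+z. ennreal (?q (x + z)) * \<phi> (u, s + (x + z)) \<partial>lborel)
          = (\<integral>\<^sup>+t. ennreal (?q t) * \<phi> (u, s + t) \<partial>lborel)"
        by (subst nn_integral_real_affine[where c = 1 and t = x]) auto
      also have "\<dots> = \<Phi> (u, s)"
        unfolding \<Phi>_def exponential_law_def fst_conv snd_conv
        by (rule nn_integral_density[symmetric]) measurable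
      finally show ?thesis .
    qed
    have "(\<integral>\<^sup>+\<omega>. \<phi> (U_of \<omega>, Y_of \<omega>) * ennreal (1 / W \<omega>) \<partial>M)
        \<le> (\<integral>\<^sup>+\<omega>. \<phi> (U_of \<omega>, Y_of \<omega>) * ennreal (1 / r (U_of \<omega>, S_of \<omega>)) * ennreal (c (X_of \<omega>) (Z_of \<omega>)) \<partial>M)"
      using X_nn by (intro nn_integral_mono_AE, eventually_elim)
        (auto simp: W_def c_def mult.assoc ennreal_mult[symmetric] r_nn less_imp_le[OF w_pos])
    also have "\<dots> = (\<integral>\<^sup>+p. \<integral>\<^sup>+z. \<phi> (U_of (p, z), Y_of (p, z)) * ennreal (1 / r (U_of (p, z), S_of (p, z)))
        * ennreal (c (X_of (p, z)) (Z_of (p, z))) \<partial>exponential_law mz \<partial>P)"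
      unfolding M_def by (rule E.nn_integral_fst[symmetric]) (unfold M_def[symmetric], measurable)
    also have "\<dots> \<le> (\<integral>\<^sup>+p. \<integral>\<^sup>+z. ennreal (1 / r (U_of (p, z), S_of (p, z)))
        * \<Phi> (U_of (p, z), S_of (p, z)) \<partial>exponential_law mz \<partial>P)"
    proof (rule nn_integral_mono)
      fix p assume "p \<in> space P"
      then obtain s u x where p: "p = (s, u, x)" and u: "u \<in> space N"
        by (cases p) (auto simp: sets_eq_imp_space_eq[OF sets_P] space_pair_measure)
      show "(\<integral>\<^sup>+z. \<phi> (U_of (p, z), Y_of (p, z)) * ennreal (1 / r (U_of (p, z), S_of (p, z)))
          * ennreal (c (X_of (p, z)) (Z_of (p, z))) \<partial>exponential_law mz)
        \<le> (\<integral>\<^sup>+z. ennreal (1 / r (U_of (p, z), S_of (p, z)))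
          * \<Phi> (U_of (p, z), S_of (p, z)) \<partial>exponential_law mz)"
        using inner[OF u, of x s] by (simp add: p of_eq Y_of_def E.emeasure_space_1)
    qed
    also have "\<dots> = (\<integral>\<^sup>+\<omega>. ennreal (1 / r (U_of \<omega>, S_of \<omega>)) * \<Phi> (U_of \<omega>, S_of \<omega>) \<partial>M)"
      unfolding M_def by (rule E.nn_integral_fst) (unfold M_def[symmetric], measurable)
    also have "\<dots> = (\<integral>\<^sup>+p. ennreal (1 / r p) * \<Phi> p \<partial>J)"
      unfolding J_def by (subst nn_integral_distr) auto
    \<comment> \<open>The factor \<open>1 / r\<close> undoes the dependence of U and S; afterwards S
      and the exponential variable combine into \<open>Q\<close>.\<close>
    also have "\<dots> \<le> (\<integral>\<^sup>+p. \<Phi> p \<partial>(A \<Otimes>\<^sub>M B))"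
      unfolding r_def by (rule r.nn_integral_inverse_le) measurable
    also have "\<dots> = (\<integral>\<^sup>+u. \<integral>\<^sup>+s. \<Phi> (u, s) \<partial>B \<partial>A)"
      by (rule B.nn_integral_fst[symmetric]) measurable
    also have "\<dots> = (\<integral>\<^sup>+u. \<integral>\<^sup>+y. \<phi> (u, y) \<partial>Q \<partial>A)"
    proof (rule nn_integral_cong)
      fix u assume "u \<in> space A"
      then have [measurable]: "u \<in> space N" by (simp add: A_def)
      have "(\<integral>\<^sup>+y. \<phi> (u, y) \<partial>Q) = (\<integral>\<^sup>+p. \<phi> (u, fst p + snd p) \<partial>(B \<Otimes>\<^sub>M exponential_law m))"
        unfolding Q_def by (subst nn_integral_distr) (auto simp: case_prod_beta')
      also have "\<dots> = (\<integral>\<^sup>+s. \<Phi> (u, s) \<partial>B)"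
        unfolding \<Phi>_def by (subst E'.nn_integral_fst[symmetric]) auto
      finally show "(\<integral>\<^sup>+s. \<Phi> (u, s) \<partial>B) = (\<integral>\<^sup>+y. \<phi> (u, y) \<partial>Q)" by simp
    qed
    also have "\<dots> = (\<integral>\<^sup>+p. \<phi> p \<partial>(A \<Otimes>\<^sub>M Q))"
      by (rule Q.nn_integral_fst) measurable
    finally show ?thesis .
  qed

  have ed: "entropy_density b (A \<Otimes>\<^sub>M B) J = (\<lambda>p. log b (r p))"
    by (simp add: fun_eq_iff entropy_density_eq_log r_def)
  have r_int: "integrable M (\<lambda>\<omega>. log b (r (U_of \<omega>, S_of \<omega>)))"
    using ed_int unfolding ed unfolding J_def by (subst (asm) integrable_distr_eq) auto
  have r_eq: "(\<integral>\<omega>. log b (r (U_of \<omega>, S_of \<omega>)) \<partial>M) = M.mutual_information b N borel U_of S_of"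
    unfolding M.mutual_information_def KL_divergence_def A_def[symmetric] B_def[symmetric]
      J_def[symmetric] ed
    unfolding J_def by (subst integral_distr) auto
  \<comment> \<open>The logarithm of \<open>w\<close>, affine in X and Z, so that only their means
    matter.\<close>
  define L where "L \<omega> = ln (m / mz) + (X_of \<omega> + Z_of \<omega>) / m - Z_of \<omega> / mz" for \<omega> :: "'u outcome"
  have L_int: "integrable M L"
    unfolding L_def using X_int Z_int by auto
  have "(\<integral>\<omega>. L \<omega> \<partial>M) = ln (m / mz) + (M.expectation X_of + mz) / m - 1"
    unfolding L_def using X_int Z_int mz by (simp add: M.prob_space Z_eq)
  \<comment> \<open>The input constraint gives X + Z mean at most \<open>m\<close>, so the two
    remaining terms have sum at most 0.\<close>
  also have "\<dots> \<le> ln (m / mz)"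
    using X_le m by (simp add: m_def)
  finally have L_le: "(\<integral>\<omega>. L \<omega> \<partial>M) \<le> ln (m / mz)" .
  \<comment> \<open>Only almost sure, because splitting the logarithm of the product uses that
    \<open>r\<close> is positive.\<close>
  have W_eq: "AE \<omega> in M. log b (r (U_of \<omega>, S_of \<omega>)) + L \<omega> / ln b = log b (W \<omega>)"
    using r_pos
  proof eventually_elim
    case (elim \<omega>)
    have "ln (w (X_of \<omega>) (Z_of \<omega>)) = L \<omega>"
      using m mz by (simp add: w_def L_def ln_mult ln_div)
    with elim show ?case
      using w_pos[of "X_of \<omega>" "Z_of \<omega>"] by (simp add: W_def log_def ln_mult add_divide_distrib)
  qed
  have [measurable]: "W \<in> borel_measurable M"
    unfolding W_def by measurable
  have [measurable]: "L \<in> borel_measurable M"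
    unfolding L_def by measurable
  have W_int: "integrable M (\<lambda>\<omega>. log b (W \<omega>))"
    by (rule integrable_cong_AE_imp[OF _ _ W_eq]) (use r_int L_int in auto)
  have lnW_int: "integrable M (\<lambda>\<omega>. ln (W \<omega>))"
    using integrable_mult_left[OF W_int, of "ln b"] b by (simp add: log_def)

  have W_pos: "AE \<omega> in M. 0 < W \<omega>"
    using r_pos by eventually_elim (simp add: W_def w_pos)
  have "ext_mutual_information b M N borel U_of Y_of \<le> ereal (\<integral>\<omega>. log b (W \<omega>) \<partial>M)"
    by (rule ext_mutual_information_le[OF M.prob_space_axioms Q b _ _ _ sets_Q W_pos lnW_int])
      (measurable, rule Q_bound[unfolded A_def])
  moreover have "(\<integral>\<omega>. log b (W \<omega>) \<partial>M) \<le> M.mutual_information b N borel U_of S_of + log b (1 + mx / mz)"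
  proof -
    have "m / mz = 1 + mx / mz"
      using mz by (simp add: m_def field_simps)
    then have "(\<integral>\<omega>. L \<omega> \<partial>M) / ln b \<le> log b (1 + mx / mz)"
      using L_le b by (simp add: log_def divide_right_mono)
    moreover have "(\<integral>\<omega>. log b (W \<omega>) \<partial>M) = (\<integral>\<omega>. log b (r (U_of \<omega>, S_of \<omega>)) + L \<omega> / ln b \<partial>M)"
      using W_eq by (intro integral_cong_AE) auto
    ultimately show ?thesis
      using r_int L_int r_eq by simp
  qed
  ultimately show ?thesis
    unfolding US_eq plus_ereal.simps by (meson ereal_less_eq(3) order_trans)
qed

section \<open>Passage to the supremum\<close>

theorem mainTheorem1:
  fixes b mx ms mz :: real
  assumes "b > 1" and "mx > 0" and "ms > 0" and "mz > 0"
  shows "gp_capacity TYPE('u) b mx ms mz \<le> ereal (log b (1 + mx / mz))"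
  unfolding gp_capacity_def
proof (rule SUP_least, clarify)
  fix N :: "'u measure" and K
  assume adm: "gp_admissible b mx ms mz N K"
  let ?M = "joint_law ms mz N K"
  have K: "K \<in> borel \<rightarrow>\<^sub>M prob_algebra (N \<Otimes>\<^sub>M borel)"
    using adm by (simp add: gp_admissible_def)
  have "ext_mutual_information b ?M N borel U_of Y_of
      \<le> ext_mutual_information b ?M N borel U_of S_of + ereal (log b (1 + mx / mz))"
    using adm unfolding gp_admissible_def Let_def joint_law_def
    by (intro mutual_information_difference_le assms joint_law_factor K) auto
  \<comment> \<open>Extended-real subtraction can be moved across the inequality only when the
    subtracted term is finite.\<close>
  moreover have "\<bar>ext_mutual_information b ?M N borel U_of S_of\<bar> \<noteq> \<infinity>"
    using adm by (auto simp: gp_admissible_def ext_mutual_information_def Let_def split: if_splits)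
  ultimately show "(let M = ?M in ext_mutual_information b M N borel U_of Y_of
      - ext_mutual_information b M N borel U_of S_of) \<le> ereal (log b (1 + mx / mz))"
    unfolding Let_def by (subst ereal_minus_le_iff) (auto simp: add.commute)
qed

end
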